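(* Let $(\xi_1,\eta_1),(\xi_2,\eta_2),\ldots$ be independent copies of an $\mathbb{R}^2$-valued random vector $(\xi,\eta)$ with arbitrarily dependent components, and let $S_0:=0$, $S_k:=\xi_1+\ldots+\xi_k$ for $k\in\mathbb{N}$. Assume that $\mu:=\mathbb{E}\xi\in(0,\infty)$, $\mathbb{E}\eta=0$ and $s^2:=\mathrm{Var}\,\eta\in(0,\infty)$. Then, as $b\to1-$, $$(1-b^2)^{1/2}\sum_{k\geq 0}b^{S_k}\eta_{k+1}\ \overset{\mathrm d}{\longrightarrow}\ (s^2\mu^{-1})^{1/2}\,\mathrm{Normal}(0,1),$$ where $\mathrm{Normal}(0,1)$ denotes a random variable with the standard normal distribution.
   Context: Here $b\in(0,1)$ and $\overset{\mathrm d}{\longrightarrow}$ denotes convergence in distribution of real random variables. Under the stated assumptions the series converges absolutely almost surely for all $b\in(0,1)$. *)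

theory Defs
  imports "HOL-Probability.Probability"
begin

text \<open>
  The library constant \<^const>\<open>weak_conv_m\<close> is restricted to sequences. The limit
  \<open>b \<rightarrow> 1-\<close> needs the same notion (convergence of distribution functions at all continuity
  points of the limit) along an arbitrary filter.
\<close>

definition weak_conv_filter ::
    "('i \<Rightarrow> real measure) \<Rightarrow> real measure \<Rightarrow> 'i filter \<Rightarrow> bool" where
  "weak_conv_filter \<nu> \<nu>' F \<longleftrightarrow>
     (\<forall>x. isCont (cdf \<nu>') x \<longrightarrow> ((\<lambda>i. cdf (\<nu> i) x) \<longlongrightarrow> cdf \<nu>' x) F)"

lemma weak_conv_filter_sequentially:
  "weak_conv_filter \<nu> \<nu>' sequentially \<longleftrightarrow> weak_conv_m \<nu> \<nu>'"
  by (simp add: weak_conv_filter_def weak_conv_m_def weak_conv_def)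

text \<open>Steps are indexed from 1, so \<^term>\<open>\<xi> 0\<close> and \<^term>\<open>\<eta> 0\<close> are never used.\<close>

definition random_walk :: "(nat \<Rightarrow> 'a \<Rightarrow> real) \<Rightarrow> nat \<Rightarrow> 'a \<Rightarrow> real" where
  "random_walk \<xi> k \<omega> = (\<Sum>i=1..k. \<xi> i \<omega>)"

text \<open>
  On the (null) event where the series diverges, \<^const>\<open>suminf\<close> returns an unspecified
  constant; this does not affect the law of the sum.
\<close>

definition discounted_sum ::
    "(nat \<Rightarrow> 'a \<Rightarrow> real) \<Rightarrow> (nat \<Rightarrow> 'a \<Rightarrow> real) \<Rightarrow> real \<Rightarrow> 'a \<Rightarrow> real" where
  "discounted_sum \<xi> \<eta> b \<omega> = (\<Sum>k. b powr random_walk \<xi> k \<omega> * \<eta> (Suc k) \<omega>)"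

end

theory Submission
  imports Defs
begin

text \<open>
  Put \<open>a = sqrt (1 - b\<^sup>2)\<close>. By the law of large numbers \<open>S\<^sub>k\<close> is close to \<open>\<mu> k\<close>, so
  the series should behave like the sum with deterministic weights
  \<open>\<Sum>k. b powr (\<mu> k) * \<eta>\<^sub>k\<^sub>+\<^sub>1\<close>. For the latter, multiplied by \<open>a\<close>, the variance is
  \<open>s\<^sup>2 (1 - b\<^sup>2) / (1 - b powr (2 * \<mu>))\<close>, which tends to \<open>s\<^sup>2 / \<mu>\<close>, while every single
  weight is at most \<open>a\<close> and tends to 0. A Lindeberg estimate of characteristic functions
  (\<open>weighted_sum_char_approx\<close>) therefore gives the normal limit.

  The difference of the two sums is controlled by orthogonality. The random variable
  \<open>b powr S\<^sub>k\<close> may have no moments, so the walk is confined to a tube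
  \<open>\<bar>S\<^sub>k - \<mu> k\<bar> \<le> \<delta> k + C\<close>. For fixed \<open>\<delta> > 0\<close> this holds for all \<open>k\<close> with
  probability close to 1 once \<open>C\<close> is large: both \<open>S\<^sub>k - (\<mu> + \<delta>) k\<close> and
  \<open>(\<mu> - \<delta>) k - S\<^sub>k\<close> are walks with negative drift, and these are almost surely bounded
  above (\<open>AE_partial_sums_bdd_above\<close>). Inside the tube the squares of the weight differences
  are bounded by a difference of two geometric sequences (\<open>powr_diff_sq_le\<close>). Since
  \<open>\<eta>\<^sub>k\<^sub>+\<^sub>1\<close> is centred and independent of \<open>S\<^sub>1, \<dots>, S\<^sub>k\<close>, second moments add up
  (\<open>predictable_sum_second_moment\<close>), and the scaled difference has second moment at most
  \<open>s\<^sup>2 (1 / (\<mu> - \<delta>) - 1 / \<mu>) + o(1)\<close> as \<open>b \<rightarrow> 1-\<close>. Letting first \<open>b \<rightarrow> 1-\<close>, then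
  \<open>C \<rightarrow> \<infinity>\<close>, then \<open>\<delta> \<rightarrow> 0\<close> identifies the limit of the characteristic functions,
  and Levy's continuity theorem along sequences \<open>b\<^sub>n \<rightarrow> 1-\<close> gives the result.
\<close>

section \<open>Random walks with negative drift\<close>

text \<open>
  The maximum of the first \<open>n + 1\<close> partial sums of \<open>x\<close>, the empty sum included, in the form
  of Lindley's recursion: the first step is split off, so that the rest of the walk enters only
  through its own maximum.
\<close>

primrec walk_max :: "nat \<Rightarrow> (nat \<Rightarrow> real) \<Rightarrow> real" where
  "walk_max 0 x = 0"
| "walk_max (Suc n) x = max 0 (x 0 + walk_max n (\<lambda>i. x (Suc i)))"

lemma walk_max_nonneg: "0 \<le> walk_max n x"
  by (cases n) auto

lemma walk_max_mono_Suc: "walk_max n x \<le> walk_max (Suc n) x"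
  by (induction n arbitrary: x) (auto intro!: max.mono simp: walk_max_nonneg simp del: max.bounded_iff)

lemma walk_max_mono: "m \<le> n \<Longrightarrow> walk_max m x \<le> walk_max n x"
  by (rule lift_Suc_mono_le[of "\<lambda>n. walk_max n x"]) (auto simp: walk_max_mono_Suc simp del: walk_max.simps)

lemma partial_sum_le_walk_max: "(\<Sum>i<n. x i) \<le> walk_max n x"
proof (induction n arbitrary: x)
  case (Suc n)
  show ?case
    using Suc[of "\<lambda>i. x (Suc i)"] by (simp add: sum.lessThan_Suc_shift del: sum.lessThan_Suc)
qed simp

definition unbounded_walk_max :: "(nat \<Rightarrow> real) \<Rightarrow> bool" where
  "unbounded_walk_max x \<longleftrightarrow> (\<forall>B::nat. \<exists>n. real B < walk_max n x)"

text \<open>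
  Unboundedness of the maxima is a property of the tail of the sequence: prepending a step \<open>a\<close>
  moves the maxima by at most \<open>\<bar>a\<bar>\<close>. This invariance replaces an appeal to a zero-one law.
\<close>

lemma unbounded_walk_max_case_nat:
  "unbounded_walk_max (case_nat a x) \<longleftrightarrow> unbounded_walk_max x"
proof
  assume L: "unbounded_walk_max (case_nat a x)"
  show "unbounded_walk_max x"
    unfolding unbounded_walk_max_def
  proof
    fix B :: nat
    obtain C :: nat where C: "real B + \<bar>a\<bar> < real C"
      using reals_Archimedean2 by blast
    from L obtain n where n: "real C < walk_max n (case_nat a x)"
      unfolding unbounded_walk_max_def by auto
    with C obtain m where "n = Suc m" by (cases n) auto
    with n C have "real B < walk_max m x" by auto
    then show "\<exists>n. real B < walk_max n x" ..
  qed
next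
  assume R: "unbounded_walk_max x"
  show "unbounded_walk_max (case_nat a x)"
    unfolding unbounded_walk_max_def
  proof
    fix B :: nat
    obtain C :: nat where C: "real B + \<bar>a\<bar> < real C"
      using reals_Archimedean2 by blast
    from R obtain n where n: "real C < walk_max n x"
      unfolding unbounded_walk_max_def by auto
    with C have "real B < walk_max (Suc n) (case_nat a x)" by auto
    then show "\<exists>n. real B < walk_max n (case_nat a x)" ..
  qed
qed

lemma measurable_walk_max [measurable]:
  assumes [measurable_cong]: "sets D = sets borel"
  shows "walk_max n \<in> borel_measurable (\<Pi>\<^sub>M i\<in>(UNIV::nat set). D)"
proof (induction n)
  case (Suc n)
  note [measurable] = Suc
  have [measurable]: "(\<lambda>x i. x (Suc i)) \<in> (\<Pi>\<^sub>M i\<in>(UNIV::nat set). D) \<rightarrow>\<^sub>M (\<Pi>\<^sub>M i\<in>(UNIV::nat set). D)"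
    by (rule measurable_PiM_single') (auto simp: space_PiM)
  have [measurable]: "(\<lambda>x. x 0) \<in> borel_measurable (\<Pi>\<^sub>M i\<in>(UNIV::nat set). D)"
    using measurable_component_singleton[of 0 UNIV "\<lambda>_. D"] assms by (simp cong: measurable_cong_sets)
  show ?case by simp
qed simp

text \<open>
  A random walk with negative drift is bounded above. Write \<open>A\<close> for the event that the running
  maxima \<open>m\<^sub>n\<close> are unbounded, and split an i.i.d. sequence into its first entry \<open>x\<close> and an
  independent sequence \<open>y\<close> with the same law as the whole. Then
  \<open>m\<^sub>n\<^sub>+\<^sub>1(x, y) = max 0 (x + m\<^sub>n(y))\<close> and \<open>A\<close> depends on \<open>y\<close> only, so integrating
  \<open>0 \<le> m\<^sub>n\<^sub>+\<^sub>1 - m\<^sub>n\<close> over \<open>A\<close> gives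
  \<open>0 \<le> E (max x (- m\<^sub>n(y)); y \<in> A)\<close>. On \<open>A\<close> the integrand tends to \<open>x\<close> and is dominated by
  \<open>\<bar>x\<bar>\<close>, whence \<open>0 \<le> E x * P(A)\<close>. This is the maximal ergodic argument.
\<close>

lemma AE_partial_sums_bdd_above:
  fixes M :: "real measure"
  assumes "prob_space M"
    and D: "sets M = sets borel" and int: "integrable M (\<lambda>x. x)"
    and neg: "(\<integral>x. x \<partial>M) < 0"
  shows "AE x in (\<Pi>\<^sub>M i\<in>(UNIV::nat set). M). \<exists>B. \<forall>n. (\<Sum>i<n. x i) \<le> B"
proof -
  interpret M: prob_space M by fact
  interpret sequence_space M ..
  note [measurable_cong] = D
  note [measurable] = measurable_walk_max[OF D]
  interpret MS: pair_prob_space M S ..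
  have space [simp]: "space M = UNIV" "space S = UNIV"
    using sets_eq_imp_space_eq[OF D] by (auto simp: space_PiM)
  define I where "I x = (indicator {x. unbounded_walk_max x} x :: real)" for x
  have [measurable]: "I \<in> borel_measurable S"
    unfolding I_def[abs_def] unbounded_walk_max_def[abs_def] by measurable
  have I_case: "I (case_nat a x) = I x" for a x
    by (simp add: I_def unbounded_walk_max_case_nat indicator_def)
  have I_le: "0 \<le> I x" "I x \<le> 1" for x
    by (auto simp: I_def)
  have [measurable]: "(\<lambda>p. case_nat (fst p) (snd p)) \<in> (M \<Otimes>\<^sub>M S) \<rightarrow>\<^sub>M S"
    by measurable
  have iter: "distr (M \<Otimes>\<^sub>M S) S (\<lambda>p. case_nat (fst p) (snd p)) = S"
    using PiM_iter by (simp add: split_beta')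
  have distr_fst: "distr (M \<Otimes>\<^sub>M S) M fst = M"
    by (rule P.distr_pair_fst)
  have distr_snd: "distr (M \<Otimes>\<^sub>M S) S snd = S"
  proof (rule measure_eqI)
    fix A assume A: "A \<in> sets (distr (M \<Otimes>\<^sub>M S) S snd)"
    then have "snd -` A \<inter> space (M \<Otimes>\<^sub>M S) = space M \<times> A"
      by (auto simp: space_pair_measure)
    with A show "emeasure (distr (M \<Otimes>\<^sub>M S) S snd) A = emeasure S A"
      using M.emeasure_space_1 by (simp add: emeasure_distr P.emeasure_pair_measure_Times)
  qed simp
  have int_fst: "integrable (M \<Otimes>\<^sub>M S) (\<lambda>p. fst p)"
    using int integrable_distr_eq[of fst "M \<Otimes>\<^sub>M S" M "\<lambda>x. x"] by (simp add: distr_fst)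
  have int_snd: "integrable (M \<Otimes>\<^sub>M S) (\<lambda>p. f (snd p))" if "integrable S f" for f :: "_ \<Rightarrow> real"
    using that integrable_distr_eq[of snd "M \<Otimes>\<^sub>M S" S f] by (simp add: distr_snd)
  have int_max: "integrable S (walk_max n)" for n
  proof (induction n)
    case 0
    then show ?case by (simp add: integrable_0)
  next
    case (Suc n)
    have "integrable (M \<Otimes>\<^sub>M S) (\<lambda>p. walk_max n (snd p))"
      by (rule int_snd[OF Suc])
    then have "integrable (M \<Otimes>\<^sub>M S) (\<lambda>p. walk_max (Suc n) (case_nat (fst p) (snd p)))"
      using int_fst by (auto intro!: integrable_max)
    then have "integrable (distr (M \<Otimes>\<^sub>M S) S (\<lambda>p. case_nat (fst p) (snd p))) (walk_max (Suc n))"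
      by (subst integrable_distr_eq) (auto simp del: walk_max.simps)
    then show ?case by (simp only: iter)
  qed
  \<comment> \<open>Both \<open>m\<^sub>n\<^sub>+\<^sub>1\<close> and \<open>m\<^sub>n\<close> are integrated over \<open>A\<close>, the former after splitting off the first
    step; their difference under the product measure is the stated integrand.\<close>
  have nonneg: "0 \<le> (\<integral>p. max (fst p) (- walk_max n (snd p)) * I (snd p) \<partial>(M \<Otimes>\<^sub>M S))" for n
  proof -
    have i1: "integrable S (\<lambda>x. walk_max n x * I x)" for n
      by (rule Bochner_Integration.integrable_bound[OF int_max[of n]])
         (auto simp: abs_mult walk_max_nonneg I_le intro!: mult_left_le)
    have i2: "integrable (M \<Otimes>\<^sub>M S) (\<lambda>p. walk_max n (snd p) * I (snd p))"
      by (rule int_snd[OF i1])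
    have e2: "(\<integral>p. walk_max n (snd p) * I (snd p) \<partial>(M \<Otimes>\<^sub>M S)) = (\<integral>x. walk_max n x * I x \<partial>S)"
      using integral_distr[of snd "M \<Otimes>\<^sub>M S" S "\<lambda>x. walk_max n x * I x"] by (simp add: distr_snd)
    have i3: "integrable (M \<Otimes>\<^sub>M S) (\<lambda>p. walk_max (Suc n) (case_nat (fst p) (snd p)) * I (snd p))"
      using i1[of "Suc n"]
        integrable_distr_eq[of "\<lambda>p. case_nat (fst p) (snd p)" "M \<Otimes>\<^sub>M S" S "\<lambda>x. walk_max (Suc n) x * I x"]
      by (simp add: iter I_case del: walk_max.simps)
    have e3: "(\<integral>p. walk_max (Suc n) (case_nat (fst p) (snd p)) * I (snd p) \<partial>(M \<Otimes>\<^sub>M S))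
        = (\<integral>x. walk_max (Suc n) x * I x \<partial>S)"
      using integral_distr[of "\<lambda>p. case_nat (fst p) (snd p)" "M \<Otimes>\<^sub>M S" S "\<lambda>x. walk_max (Suc n) x * I x"]
      by (simp add: iter I_case del: walk_max.simps)
    have "0 \<le> (\<integral>x. walk_max (Suc n) x * I x \<partial>S) - (\<integral>x. walk_max n x * I x \<partial>S)"
      using integral_mono[OF i1 i1, of n "Suc n"] walk_max_mono_Suc[of n] I_le
      by (auto intro!: mult_right_mono simp del: walk_max.simps)
    also have "\<dots> = (\<integral>p. walk_max (Suc n) (case_nat (fst p) (snd p)) * I (snd p)
        - walk_max n (snd p) * I (snd p) \<partial>(M \<Otimes>\<^sub>M S))"
      using i2 i3 e2 e3 by (simp del: walk_max.simps)
    also have "\<dots> = (\<integral>p. max (fst p) (- walk_max n (snd p)) * I (snd p) \<partial>(M \<Otimes>\<^sub>M S))"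
      by (rule Bochner_Integration.integral_cong) (auto simp: max_def algebra_simps)
    finally show ?thesis .
  qed
  have "(\<lambda>n. \<integral>p. max (fst p) (- walk_max n (snd p)) * I (snd p) \<partial>(M \<Otimes>\<^sub>M S))
      \<longlonglongrightarrow> (\<integral>p. fst p * I (snd p) \<partial>(M \<Otimes>\<^sub>M S))"
  proof (rule integral_dominated_convergence[where w = "\<lambda>p. \<bar>fst p\<bar>"])
    show "AE p in M \<Otimes>\<^sub>M S. (\<lambda>n. max (fst p) (- walk_max n (snd p)) * I (snd p)) \<longlonglongrightarrow> fst p * I (snd p)"
    proof (rule AE_I2)
      fix p :: "real \<times> (nat \<Rightarrow> real)"
      show "(\<lambda>n. max (fst p) (- walk_max n (snd p)) * I (snd p)) \<longlonglongrightarrow> fst p * I (snd p)"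
      proof (cases "unbounded_walk_max (snd p)")
        case True
        obtain B :: nat where B: "\<bar>fst p\<bar> < real B" using reals_Archimedean2 by blast
        obtain n where n: "real B < walk_max n (snd p)"
          using True unfolding unbounded_walk_max_def by auto
        have "max (fst p) (- walk_max m (snd p)) = fst p" if "n \<le> m" for m
          using walk_max_mono[OF that, of "snd p"] n B by auto
        then show ?thesis
          by (intro tendsto_eventually) (auto simp: eventually_sequentially)
      qed (simp add: I_def)
    qed
    show "AE p in M \<Otimes>\<^sub>M S. norm (max (fst p) (- walk_max n (snd p)) * I (snd p)) \<le> \<bar>fst p\<bar>" for n
    proof (rule AE_I2)
      fix p :: "real \<times> (nat \<Rightarrow> real)"
      have "\<bar>max (fst p) (- walk_max n (snd p))\<bar> * I (snd p) \<le> \<bar>fst p\<bar> * 1"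
        using walk_max_nonneg[of n "snd p"] I_le by (intro mult_mono) auto
      then show "norm (max (fst p) (- walk_max n (snd p)) * I (snd p)) \<le> \<bar>fst p\<bar>"
        using I_le by (simp add: abs_mult)
    qed
  qed (use int_fst in auto)
  then have "0 \<le> (\<integral>p. fst p * I (snd p) \<partial>(M \<Otimes>\<^sub>M S))"
    by (rule LIMSEQ_le_const) (use nonneg in auto)
  also have "\<dots> = (\<integral>x. x \<partial>M) * (\<integral>x. I x \<partial>S)"
  proof -
    have "integrable (M \<Otimes>\<^sub>M S) (\<lambda>p. fst p * I (snd p))"
      by (rule Bochner_Integration.integrable_bound[OF int_fst])
         (auto simp: abs_mult I_le intro!: mult_left_le)
    from MS.integral_fst'[OF this] show ?thesis by simp
  qed
  finally have "(\<integral>x. I x \<partial>S) \<le> 0"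
    using neg by (simp add: zero_le_mult_iff)
  moreover have "integrable S I"
    by (rule P.integrable_const_bound[where B = 1]) (auto simp: I_le)
  ultimately have "AE x in S. I x = 0"
    using integral_nonneg_eq_0_iff_AE[of S I] I_le
    by (metis (mono_tags, lifting) AE_I2 Bochner_Integration.integral_nonneg order_antisym)
  then show ?thesis
  proof eventually_elim
    case (elim x)
    then obtain B :: nat where "\<forall>n. walk_max n x \<le> B"
      by (auto simp: I_def unbounded_walk_max_def indicator_def not_less split: if_splits)
    then show ?case
      using partial_sum_le_walk_max order_trans by blast
  qed
qed

lemma (in prob_space) AE_iid_sums_bdd_above:
  fixes Z :: "nat \<Rightarrow> 'a \<Rightarrow> real"
  assumes indep: "indep_vars (\<lambda>_. borel) Z UNIV"
    and law: "\<And>i. distr M borel (Z i) = distr M borel (Z 0)"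
    and int: "integrable M (Z 0)" and neg: "expectation (Z 0) < 0"
  shows "AE \<omega> in M. \<exists>B. \<forall>n. (\<Sum>i<n. Z i \<omega>) \<le> B"
proof -
  have rv [measurable]: "random_variable borel (Z i)" for i
    using indep by (simp add: indep_vars_def2)
  define D where "D = distr M borel (Z 0)"
  have law_D: "distr M borel (Z i) = D" for i
    unfolding D_def by (rule law)
  have "prob_space D" unfolding D_def by (rule prob_space_distr) simp
  moreover have "integrable D (\<lambda>x. x)" "(\<integral>x. x \<partial>D) < 0"
    using int neg by (simp_all add: D_def integrable_distr_eq integral_distr)
  ultimately have "AE x in (\<Pi>\<^sub>M i\<in>(UNIV::nat set). D). \<exists>B. \<forall>n. (\<Sum>i<n. x i) \<le> B"
    by (intro AE_partial_sums_bdd_above) (simp_all add: D_def)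
  also have "(\<Pi>\<^sub>M i\<in>(UNIV::nat set). D) = distr M (\<Pi>\<^sub>M i\<in>(UNIV::nat set). borel) (\<lambda>\<omega> i. Z i \<omega>)"
    using indep_vars_iff_distr_eq_PiM[of "UNIV :: nat set" Z "\<lambda>_. borel"] indep
    by (simp add: law_D restrict_UNIV)
  finally have "AE x in distr M (\<Pi>\<^sub>M i\<in>(UNIV::nat set). borel) (\<lambda>\<omega> i. Z i \<omega>).
      \<exists>B. \<forall>n. (\<Sum>i<n. x i) \<le> (B::real)" .
  then show ?thesis
    by (rule AE_distrD[rotated]) (rule measurable_PiM_single', auto)
qed

text \<open>
  The strong law of large numbers in the form needed here: the affine images \<open>Z - m - \<delta>\<close> and
  \<open>m - \<delta> - Z\<close> have negative mean, so both walks stay bounded. A linear error with a random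
  constant, uniform in \<open>n\<close>, is more convenient below than convergence of averages.
\<close>

lemma (in prob_space) AE_iid_sums_linear_deviation:
  fixes Z :: "nat \<Rightarrow> 'a \<Rightarrow> real"
  assumes indep: "indep_vars (\<lambda>_. borel) Z UNIV"
    and law: "\<And>i. distr M borel (Z i) = distr M borel (Z 0)"
    and int: "integrable M (Z 0)" and m: "expectation (Z 0) = m" and \<delta>: "0 < (\<delta>::real)"
  shows "AE \<omega> in M. \<exists>C::nat. \<forall>n. \<bar>(\<Sum>i<n. Z i \<omega>) - m * n\<bar> \<le> \<delta> * n + C"
proof -
  have rv [measurable]: "random_variable borel (Z i)" for i
    using indep by (simp add: indep_vars_def2)
  have affine: "AE \<omega> in M. \<exists>B. \<forall>n. (\<Sum>i<n. c * Z i \<omega> + d) \<le> B" if "c * m + d < 0" for c d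
  proof (rule AE_iid_sums_bdd_above)
    show "indep_vars (\<lambda>_. borel) (\<lambda>i \<omega>. c * Z i \<omega> + d) UNIV"
      by (rule indep_vars_compose2[OF indep]) simp
    fix i
    have "distr M borel (\<lambda>\<omega>. c * Z i \<omega> + d) = distr (distr M borel (Z i)) borel (\<lambda>x. c * x + d)" for i
      by (subst distr_distr) (auto simp: comp_def)
    then show "distr M borel (\<lambda>\<omega>. c * Z i \<omega> + d) = distr M borel (\<lambda>\<omega>. c * Z 0 \<omega> + d)"
      using law by metis
  qed (use that int m prob_space in simp_all)
  have "AE \<omega> in M. \<exists>B. \<forall>n. (\<Sum>i<n. 1 * Z i \<omega> + (- m - \<delta>)) \<le> B"
    using \<delta> by (intro affine) simp
  moreover have "AE \<omega> in M. \<exists>B. \<forall>n. (\<Sum>i<n. (-1) * Z i \<omega> + (m - \<delta>)) \<le> B"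
    using \<delta> by (intro affine) simp
  ultimately show ?thesis
  proof eventually_elim
    case (elim \<omega>)
    then obtain B1 B2 where B: "\<And>n. (\<Sum>i<n. 1 * Z i \<omega> + (- m - \<delta>)) \<le> B1"
      "\<And>n. (\<Sum>i<n. (-1) * Z i \<omega> + (m - \<delta>)) \<le> B2" by blast
    obtain C :: nat where C: "max B1 B2 \<le> real C" using real_arch_simple by blast
    have "\<bar>(\<Sum>i<n. Z i \<omega>) - m * n\<bar> \<le> \<delta> * n + C" for n
      using B(1)[of n] B(2)[of n] C unfolding sum.distrib sum_distrib_left[symmetric]
      by (auto simp: algebra_simps abs_le_iff)
    then show ?case by blast
  qed
qed

section \<open>A random walk driven by i.i.d. pairs\<close>

text \<open>
  The components of a pair may be dependent. Steps are indexed from 0, so \<open>Y k\<close> is paired with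
  the increment \<open>X k\<close> that comes after \<open>walk k\<close>, and is therefore independent of \<open>walk k\<close>.
\<close>

locale iid_pairs = prob_space M for M :: "'a measure" +
  fixes X Y :: "nat \<Rightarrow> 'a \<Rightarrow> real" and \<mu> s :: real
  assumes indep: "indep_vars (\<lambda>_. borel) (\<lambda>i \<omega>. (X i \<omega>, Y i \<omega>)) UNIV"
    and law: "\<And>i. distr M borel (\<lambda>\<omega>. (X i \<omega>, Y i \<omega>)) = distr M borel (\<lambda>\<omega>. (X 0 \<omega>, Y 0 \<omega>))"
    and X_integrable: "integrable M (X 0)" and X_mean: "expectation (X 0) = \<mu>"
    and Y_mean: "expectation (Y 0) = 0"
    and Y_sq_integrable0: "integrable M (\<lambda>\<omega>. (Y 0 \<omega>)\<^sup>2)"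
    and Y_second_moment0: "expectation (\<lambda>\<omega>. (Y 0 \<omega>)\<^sup>2) = s\<^sup>2"
    and \<mu>_pos: "0 < \<mu>"
begin

definition walk :: "nat \<Rightarrow> 'a \<Rightarrow> real" where "walk k \<omega> = (\<Sum>i<k. X i \<omega>)"

lemma rv_pair [measurable]: "random_variable borel (\<lambda>\<omega>. (X i \<omega>, Y i \<omega>))"
  using indep by (simp add: indep_vars_def2)

lemma rv_X [measurable]: "random_variable borel (X i)"
proof -
  have "(\<lambda>\<omega>. fst (X i \<omega>, Y i \<omega>)) \<in> borel_measurable M"
    by (rule measurable_compose[OF rv_pair]) (simp add: borel_prod[symmetric])
  then show ?thesis by simp
qed

lemma rv_Y [measurable]: "random_variable borel (Y i)"
proof -
  have "(\<lambda>\<omega>. snd (X i \<omega>, Y i \<omega>)) \<in> borel_measurable M"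
    by (rule measurable_compose[OF rv_pair]) (simp add: borel_prod[symmetric])
  then show ?thesis by simp
qed

lemma measurable_walk [measurable]: "walk k \<in> borel_measurable M"
  unfolding walk_def[abs_def] by measurable

lemma law_X: "distr M borel (X i) = distr M borel (X 0)"
proof -
  have "distr M borel (X i) = distr (distr M borel (\<lambda>\<omega>. (X i \<omega>, Y i \<omega>))) borel fst" for i
    by (subst distr_distr) (auto simp: comp_def borel_prod[symmetric])
  then show ?thesis using law by metis
qed

lemma law_Y: "distr M borel (Y i) = distr M borel (Y 0)"
proof -
  have "distr M borel (Y i) = distr (distr M borel (\<lambda>\<omega>. (X i \<omega>, Y i \<omega>))) borel snd" for i
    by (subst distr_distr) (auto simp: comp_def borel_prod[symmetric])
  then show ?thesis using law by metis
qed

lemma indep_X: "indep_vars (\<lambda>_. borel) X UNIV"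
proof -
  have "indep_vars (\<lambda>_. borel) (\<lambda>i \<omega>. fst (X i \<omega>, Y i \<omega>)) UNIV"
    by (rule indep_vars_compose2[OF indep]) (simp add: borel_prod[symmetric])
  then show ?thesis by simp
qed

lemma indep_Y: "indep_vars (\<lambda>_. borel) Y UNIV"
proof -
  have "indep_vars (\<lambda>_. borel) (\<lambda>i \<omega>. snd (X i \<omega>, Y i \<omega>)) UNIV"
    by (rule indep_vars_compose2[OF indep]) (simp add: borel_prod[symmetric])
  then show ?thesis by simp
qed

lemma
  assumes [measurable]: "f \<in> borel_measurable borel"
  shows integrable_Y_iff: "integrable M (\<lambda>\<omega>. f (Y i \<omega>) :: real) \<longleftrightarrow> integrable M (\<lambda>\<omega>. f (Y 0 \<omega>))"
    and integral_Y_eq: "expectation (\<lambda>\<omega>. f (Y i \<omega>)) = expectation (\<lambda>\<omega>. f (Y 0 \<omega>))"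
proof -
  show "integrable M (\<lambda>\<omega>. f (Y i \<omega>) :: real) \<longleftrightarrow> integrable M (\<lambda>\<omega>. f (Y 0 \<omega>))"
    using integrable_distr_eq[of "Y i" M borel f] integrable_distr_eq[of "Y 0" M borel f] law_Y[of i]
    by simp
  show "expectation (\<lambda>\<omega>. f (Y i \<omega>)) = expectation (\<lambda>\<omega>. f (Y 0 \<omega>))"
    using integral_distr[of "Y i" M borel f] integral_distr[of "Y 0" M borel f] law_Y[of i]
    by simp
qed

lemma Y_sq_integrable: "integrable M (\<lambda>\<omega>. (Y i \<omega>)\<^sup>2)"
  using integrable_Y_iff[of "\<lambda>y. y\<^sup>2" i] Y_sq_integrable0 by simp

lemma Y_integrable: "integrable M (Y i)"
  by (rule square_integrable_imp_integrable[OF rv_Y Y_sq_integrable])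

lemma Y_expectation: "expectation (Y i) = 0"
  using integral_Y_eq[of "\<lambda>y. y" i] Y_mean by simp

lemma Y_second_moment: "expectation (\<lambda>\<omega>. (Y i \<omega>)\<^sup>2) = s\<^sup>2"
  using integral_Y_eq[of "\<lambda>y. y\<^sup>2" i] Y_second_moment0 by simp

text \<open>
  The event that the walk stays within \<open>\<delta> k + C\<close> of its mean for all times \<open>k\<close>. It allows
  moments of \<open>b powr walk k\<close>, which may be infinite, to be replaced by deterministic bounds.
\<close>

definition tube :: "real \<Rightarrow> nat \<Rightarrow> 'a set" where
  "tube \<delta> C = {\<omega> \<in> space M. \<forall>k. \<bar>walk k \<omega> - \<mu> * k\<bar> \<le> \<delta> * k + C}"

lemma sets_tube [measurable]: "tube \<delta> C \<in> events"
  unfolding tube_def by measurable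

lemma AE_linear_deviation:
  fixes \<delta> :: real
  assumes "0 < \<delta>"
  shows "AE \<omega> in M. \<exists>C::nat. \<forall>k. \<bar>walk k \<omega> - \<mu> * k\<bar> \<le> \<delta> * k + C"
  unfolding walk_def
  by (rule AE_iid_sums_linear_deviation[OF indep_X law_X X_integrable X_mean assms])

lemma prob_tube_tendsto:
  assumes "0 < \<delta>"
  shows "(\<lambda>C. prob (space M - tube \<delta> C)) \<longlonglongrightarrow> 0"
proof -
  have "incseq (tube \<delta>)"
    unfolding incseq_def tube_def
  proof safe
    fix m n :: nat and \<omega> k
    assume "m \<le> n" and *: "\<forall>k. \<bar>walk k \<omega> - \<mu> * k\<bar> \<le> \<delta> * k + m"
    then have "real m \<le> real n" by simp
    with *[rule_format, of k] show "\<bar>walk k \<omega> - \<mu> * k\<bar> \<le> \<delta> * k + n" by linarith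
  qed
  then have "(\<lambda>C. prob (tube \<delta> C)) \<longlonglongrightarrow> prob (\<Union>C. tube \<delta> C)"
    by (intro finite_Lim_measure_incseq) auto
  moreover have "prob (\<Union>C. tube \<delta> C) = 1"
    using AE_linear_deviation[OF assms] by (intro prob_eq_1[THEN iffD2]) (auto simp: tube_def)
  ultimately have "(\<lambda>C. 1 - prob (tube \<delta> C)) \<longlonglongrightarrow> 1 - 1"
    by (intro tendsto_intros) simp
  then show ?thesis by (simp add: prob_compl)
qed

lemma AE_geometric_Y_summable:
  assumes q: "0 \<le> q" "q < 1"
  shows "AE \<omega> in M. summable (\<lambda>k. q ^ k * \<bar>Y k \<omega>\<bar>)"
proof -
  have "(\<integral>\<^sup>+\<omega>. (\<Sum>k. ennreal (q ^ k * \<bar>Y k \<omega>\<bar>)) \<partial>M) = (\<Sum>k. \<integral>\<^sup>+\<omega>. ennreal (q ^ k * \<bar>Y k \<omega>\<bar>) \<partial>M)"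
    by (rule nn_integral_suminf) simp
  also have "\<dots> = (\<Sum>k. ennreal (q ^ k * expectation (\<lambda>\<omega>. \<bar>Y 0 \<omega>\<bar>)))"
  proof (rule suminf_cong)
    fix k
    show "(\<integral>\<^sup>+\<omega>. ennreal (q ^ k * \<bar>Y k \<omega>\<bar>) \<partial>M) = ennreal (q ^ k * expectation (\<lambda>\<omega>. \<bar>Y 0 \<omega>\<bar>))"
      using Y_integrable[of k] q integral_Y_eq[of abs k]
      by (subst nn_integral_eq_integral) auto
  qed
  also have "\<dots> \<noteq> \<infinity>"
  proof -
    have "summable (\<lambda>k. q ^ k * expectation (\<lambda>\<omega>. \<bar>Y 0 \<omega>\<bar>))"
      using q by (intro summable_mult2 summable_geometric) simp
    then show ?thesis
      using q by (subst suminf_ennreal2) auto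
  qed
  finally have "AE \<omega> in M. (\<Sum>k. ennreal (q ^ k * \<bar>Y k \<omega>\<bar>)) \<noteq> \<infinity>"
    by (intro nn_integral_PInf_AE) auto
  then show ?thesis
    by eventually_elim (use q in \<open>auto intro: summable_suminf_not_top\<close>)
qed

text \<open>
  Almost surely the walk exceeds \<open>\<mu> k / 2\<close> up to a random constant, so the weights are
  dominated by a geometric sequence.
\<close>

lemma AE_discounted_summable:
  assumes b: "0 < b" "b < 1"
  shows "AE \<omega> in M. summable (\<lambda>k. b powr walk k \<omega> * Y k \<omega>)"
proof -
  have half_pos: "0 < \<mu> / 2" using \<mu>_pos by simp
  define q where "q = b powr (\<mu> / 2)"
  have q: "0 \<le> q" "q < 1"
    using b \<mu>_pos powr_less_mono2[of "\<mu> / 2" b 1] by (auto simp: q_def )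
  show ?thesis
    using AE_geometric_Y_summable[OF q] AE_linear_deviation[OF half_pos]
  proof eventually_elim
    case (elim \<omega>)
    then obtain C :: nat where C: "\<And>k. \<bar>walk k \<omega> - \<mu> * k\<bar> \<le> \<mu> / 2 * k + C" by blast
    show "summable (\<lambda>k. b powr walk k \<omega> * Y k \<omega>)"
    proof (rule summable_comparison_test')
      show "summable (\<lambda>k. b powr (- real C) * (q ^ k * \<bar>Y k \<omega>\<bar>))"
        by (rule summable_mult[OF elim(1)])
      fix k
      have "b powr walk k \<omega> \<le> b powr (- real C + \<mu> / 2 * k)"
        using C[of k] b by (intro powr_mono') (auto simp: abs_le_iff)
      also have "\<dots> = b powr (- real C) * q ^ k"
        using b by (simp add: powr_add[symmetric] q_def powr_power algebra_simps)
      finally show "norm (b powr walk k \<omega> * Y k \<omega>) \<le> b powr (- real C) * (q ^ k * \<bar>Y k \<omega>\<bar>)"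
        by (simp add: abs_mult mult_right_mono mult.assoc[symmetric])
    qed
  qed
qed

text \<open>
  The dependence within a pair is harmless because only pairs with index below \<open>n\<close> enter the past.
\<close>

lemma indep_past_Y:
  assumes "G \<in> borel_measurable (\<Pi>\<^sub>M i\<in>{..<n}. borel)"
  shows "indep_var borel (\<lambda>\<omega>. G (\<lambda>i\<in>{..<n}. (X i \<omega>, Y i \<omega>)) :: real) borel (Y n)"
proof -
  have "indep_var (\<Pi>\<^sub>M i\<in>{..<n}. borel) (\<lambda>\<omega>. \<lambda>i\<in>{..<n}. (X i \<omega>, Y i \<omega>))
      (\<Pi>\<^sub>M i\<in>{n}. borel) (\<lambda>\<omega>. \<lambda>i\<in>{n}. (X i \<omega>, Y i \<omega>))"
    by (rule indep_var_restrict[OF indep]) auto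
  moreover have "(\<lambda>x. snd (x n)) \<in> borel_measurable (\<Pi>\<^sub>M i\<in>{n}. (borel :: (real \<times> real) measure))"
    by (rule measurable_compose[OF measurable_component_singleton]) (auto simp: borel_prod[symmetric])
  ultimately have "indep_var borel (G \<circ> (\<lambda>\<omega>. \<lambda>i\<in>{..<n}. (X i \<omega>, Y i \<omega>)))
      borel ((\<lambda>x. snd (x n)) \<circ> (\<lambda>\<omega>. \<lambda>i\<in>{n}. (X i \<omega>, Y i \<omega>)))"
    using assms by (intro indep_var_compose)
  then show ?thesis by (simp add: comp_def)
qed

text \<open>
  The summands are orthogonal: the weight of \<open>Y n\<close> and the preceding partial sum are functions
  of earlier pairs, and \<open>Y n\<close> is centred. Hence the cross term in the recursion for the second
  moment vanishes.
\<close>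

lemma predictable_sum_second_moment:
  fixes f :: "nat \<Rightarrow> real \<Rightarrow> real"
  assumes f [measurable]: "\<And>k. f k \<in> borel_measurable borel" and bound: "\<And>k x. (f k x)\<^sup>2 \<le> c k"
  shows "integrable M (\<lambda>\<omega>. (\<Sum>k<n. f k (walk k \<omega>) * Y k \<omega>)\<^sup>2) \<and>
    expectation (\<lambda>\<omega>. (\<Sum>k<n. f k (walk k \<omega>) * Y k \<omega>)\<^sup>2) \<le> s\<^sup>2 * (\<Sum>k<n. c k)"
proof (induction n)
  case (Suc n)
  define U where "U \<omega> = (\<Sum>k<n. f k (walk k \<omega>) * Y k \<omega>)" for \<omega>
  define V where "V \<omega> = f n (walk n \<omega>)" for \<omega>
  have [measurable]: "U \<in> borel_measurable M" "V \<in> borel_measurable M"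
    unfolding U_def[abs_def] V_def[abs_def] by measurable
  have c: "0 \<le> c k" for k using bound[of k 0] by (rule order_trans[rotated]) simp
  have V_bound: "\<bar>V \<omega>\<bar> \<le> sqrt (c n)" "(V \<omega>)\<^sup>2 \<le> c n" for \<omega>
    using bound[of n] real_le_rsqrt[of "\<bar>V \<omega>\<bar>" "c n"] by (auto simp: V_def)
  have U2: "integrable M (\<lambda>\<omega>. (U \<omega>)\<^sup>2)" "expectation (\<lambda>\<omega>. (U \<omega>)\<^sup>2) \<le> s\<^sup>2 * (\<Sum>k<n. c k)"
    using Suc by (simp_all add: U_def)
  have VY: "integrable M (\<lambda>\<omega>. (V \<omega>)\<^sup>2 * (Y n \<omega>)\<^sup>2)"
    by (rule Bochner_Integration.integrable_bound[OF integrable_mult_right[OF Y_sq_integrable[of n], of "c n"]])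
       (use V_bound c in \<open>auto intro!: mult_right_mono\<close>)
  have UV: "integrable M (\<lambda>\<omega>. U \<omega> * V \<omega>)"
  proof (rule Bochner_Integration.integrable_bound)
    show "integrable M (\<lambda>\<omega>. sqrt (c n) * U \<omega>)"
      using square_integrable_imp_integrable[OF _ U2(1)] by simp
  qed (use V_bound c in \<open>auto simp: abs_mult mult.commute intro!: mult_left_mono\<close>)
  \<comment> \<open>\<open>G\<close> exhibits the partial sum times the next weight as a function of the pairs before \<open>n\<close>.\<close>
  define G where "G x = (\<Sum>k<n. f k (\<Sum>i<k. fst (x i)) * snd (x k)) * f n (\<Sum>i<n. fst (x i))"
    for x :: "nat \<Rightarrow> real \<times> real"
  have "G \<in> borel_measurable (\<Pi>\<^sub>M i\<in>{..<n}. borel)"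
  proof -
    have fstm: "(\<lambda>x. fst (x i)) \<in> borel_measurable (\<Pi>\<^sub>M i\<in>{..<n}. (borel :: (real \<times> real) measure))"
      and sndm: "(\<lambda>x. snd (x i)) \<in> borel_measurable (\<Pi>\<^sub>M i\<in>{..<n}. (borel :: (real \<times> real) measure))"
      if "i < n" for i
      using that by (auto intro!: measurable_compose[OF measurable_component_singleton] simp: borel_prod[symmetric])
    show ?thesis
      unfolding G_def[abs_def]
      by (intro borel_measurable_times borel_measurable_sum measurable_compose[OF _ f] fstm sndm) auto
  qed
  note indep_past_Y[OF this]
  moreover have "G (\<lambda>i\<in>{..<n}. (X i \<omega>, Y i \<omega>)) = U \<omega> * V \<omega>" for \<omega>
    unfolding G_def U_def V_def walk_def by (intro arg_cong2[where f = "(*)"] sum.cong arg_cong[where f = "f _"]) auto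
  ultimately have "indep_var borel (\<lambda>\<omega>. U \<omega> * V \<omega>) borel (Y n)"
    by simp
  from indep_var_integrable[OF this UV Y_integrable] indep_var_lebesgue_integral[OF this UV Y_integrable]
  have UVY: "integrable M (\<lambda>\<omega>. U \<omega> * V \<omega> * Y n \<omega>)" "expectation (\<lambda>\<omega>. U \<omega> * V \<omega> * Y n \<omega>) = 0"
    by (simp_all add: Y_expectation)
  have eq: "(\<Sum>k<Suc n. f k (walk k \<omega>) * Y k \<omega>)\<^sup>2
      = (U \<omega>)\<^sup>2 + 2 * (U \<omega> * V \<omega> * Y n \<omega>) + (V \<omega>)\<^sup>2 * (Y n \<omega>)\<^sup>2" for \<omega>
    by (simp add: U_def V_def power2_eq_square algebra_simps)
  have "expectation (\<lambda>\<omega>. (V \<omega>)\<^sup>2 * (Y n \<omega>)\<^sup>2) \<le> expectation (\<lambda>\<omega>. c n * (Y n \<omega>)\<^sup>2)"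
    by (rule integral_mono[OF VY]) (use V_bound in \<open>auto intro!: mult_right_mono Y_sq_integrable\<close>)
  also have "\<dots> = c n * s\<^sup>2"
    by (simp add: Y_second_moment)
  finally show ?case
    unfolding eq using U2 UVY VY by (simp add: distrib_left mult.commute[of "c n"])
qed simp

end

section \<open>Auxiliary inequalities\<close>

text \<open>
  With \<open>x = b powr (w - m)\<close> and \<open>p = b powr (- d) \<ge> 1\<close> it holds that \<open>1 / p \<le> x \<le> p\<close>, and therefore
  \<open>\<bar>x - 1\<bar> \<le> p - 1\<close>. The cruder bound \<open>(p - 1)\<^sup>2 \<le> p\<^sup>2 - 1\<close> is taken because, for \<open>m\<close>
  and \<open>d\<close> affine in an index, the right-hand side becomes a difference of two geometric sequences.
\<close>

lemma powr_diff_sq_le: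
  fixes b w m d :: real
  assumes b: "0 < b" "b < 1" and w: "\<bar>w - m\<bar> \<le> d"
  shows "(b powr w - b powr m)\<^sup>2 \<le> b powr (2 * m - 2 * d) - b powr (2 * m)"
proof -
  define x where "x = b powr (w - m)"
  define p where "p = b powr (- d)"
  have p: "1 \<le> p"
    using powr_mono'[of "- d" 0 b] b w by (simp add: p_def)
  have "x \<le> p" unfolding x_def p_def using b w by (intro powr_mono') auto
  moreover have "1 / p \<le> x"
  proof -
    have "b powr d \<le> x" unfolding x_def using b w by (intro powr_mono') auto
    then show ?thesis using b by (simp add: p_def powr_minus field_simps)
  qed
  moreover have "1 - 1 / p \<le> p - 1"
  proof -
    have "0 \<le> (p - 1)\<^sup>2 / p" using p by simp
    then show ?thesis using p by (simp add: field_simps power2_eq_square)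
  qed
  ultimately have "\<bar>x - 1\<bar> \<le> p - 1" by (auto simp: abs_le_iff)
  then have "(x - 1)\<^sup>2 \<le> (p - 1)\<^sup>2" by (metis abs_ge_zero power2_abs power_mono)
  also have "\<dots> \<le> p\<^sup>2 - 1"
    using p by (simp add: power2_eq_square algebra_simps)
  finally have "(b powr m)\<^sup>2 * (x - 1)\<^sup>2 \<le> (b powr m)\<^sup>2 * (p\<^sup>2 - 1)"
    by (intro mult_left_mono) auto
  moreover have "b powr w = b powr m * x" using b by (simp add: x_def powr_add[symmetric])
  moreover have "b powr (2 * m) = (b powr m)\<^sup>2" using b by (simp add: powr_power)
  moreover have "b powr (2 * m - 2 * d) = (b powr m)\<^sup>2 * p\<^sup>2"
    using b by (simp add: p_def powr_power powr_add[symmetric])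
  ultimately show ?thesis by (simp add: algebra_simps power2_eq_square)
qed

lemma exp_neg_quadratic_bound:
  fixes x :: real
  assumes "0 \<le> x"
  shows "\<bar>(1 - x) - exp (- x)\<bar> \<le> x\<^sup>2 / 2"
proof -
  have pos: "0 < 1 + x + x\<^sup>2 / 2" using assms by (simp add: add_pos_nonneg)
  have "exp (- x) = 1 / exp x" by (simp add: exp_minus divide_inverse)
  also have "\<dots> \<le> 1 / (1 + x + x\<^sup>2 / 2)"
    using exp_lower_Taylor_quadratic[OF assms] pos by (intro divide_left_mono) auto
  also have "\<dots> \<le> 1 - x + x\<^sup>2 / 2"
  proof -
    have "(1 - x + x\<^sup>2 / 2) * (1 + x + x\<^sup>2 / 2) = 1 + (x\<^sup>2)\<^sup>2 / 4"
      by (simp add: power2_eq_square field_simps)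
    also have "\<dots> \<ge> 1" by simp
    finally show ?thesis using pos by (simp add: divide_le_eq)
  qed
  finally show ?thesis using exp_ge_add_one_self[of "- x"] by (auto simp: abs_le_iff)
qed

lemma norm_iexp_diff_le: "cmod (iexp u - iexp v) \<le> \<bar>u - v\<bar>"
proof -
  have "iexp u - iexp v = iexp v * (iexp (u - v) - 1)"
    by (simp add: right_diff_distrib exp_add[symmetric] algebra_simps)
  also have "cmod \<dots> = cmod (iexp (u - v) - 1)" by (simp add: norm_mult)
  also have "\<dots> \<le> \<bar>u - v\<bar>" using iexp_approx1[of "u - v" 0] by simp
  finally show ?thesis .
qed

lemma (in prob_space) expectation_abs_le_sqrt:
  fixes U :: "'a \<Rightarrow> real"
  assumes [measurable]: "random_variable borel U" and U: "integrable M (\<lambda>\<omega>. (U \<omega>)\<^sup>2)"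
  shows "expectation (\<lambda>\<omega>. \<bar>U \<omega>\<bar>) \<le> sqrt (expectation (\<lambda>\<omega>. (U \<omega>)\<^sup>2))"
proof (rule real_le_rsqrt)
  have "integrable M (\<lambda>\<omega>. \<bar>U \<omega>\<bar>)"
    using square_integrable_imp_integrable[OF _ U] by simp
  from variance_eq[OF this] variance_positive[of "\<lambda>\<omega>. \<bar>U \<omega>\<bar>"] U
  show "(expectation (\<lambda>\<omega>. \<bar>U \<omega>\<bar>))\<^sup>2 \<le> expectation (\<lambda>\<omega>. (U \<omega>)\<^sup>2)" by simp
qed

lemma geometric_sum_le:
  fixes q :: real
  assumes "0 \<le> q" "q < 1"
  shows "(\<Sum>k<n. q ^ k) \<le> 1 / (1 - q)"
  using sum_le_suminf[OF summable_geometric[of q], of "{..<n}"] suminf_geometric[of q] assms by simp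

context iid_pairs
begin

section \<open>Deterministic weights\<close>

text \<open>
  The error functional of the second-order expansion of a characteristic function; it tends to 0
  with \<open>u\<close> although the third moment of \<open>Y 0\<close> may be infinite.
\<close>

definition truncated_third_moment :: "real \<Rightarrow> real" where
  "truncated_third_moment u = expectation (\<lambda>\<omega>. min (6 * (Y 0 \<omega>)\<^sup>2) (u * \<bar>Y 0 \<omega>\<bar> ^ 3))"

lemma truncated_third_moment_integrable:
  "0 \<le> u \<Longrightarrow> integrable M (\<lambda>\<omega>. min (6 * (Y 0 \<omega>)\<^sup>2) (u * \<bar>Y 0 \<omega>\<bar> ^ 3))"
  by (rule Bochner_Integration.integrable_bound[OF integrable_mult_right[OF Y_sq_integrable0, of 6]])
     (auto simp: min_def not_le)

lemma truncated_third_moment_mono: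
  "0 \<le> u \<Longrightarrow> u \<le> v \<Longrightarrow> truncated_third_moment u \<le> truncated_third_moment v"
  unfolding truncated_third_moment_def
  by (intro integral_mono truncated_third_moment_integrable min.mono mult_right_mono) auto

lemma truncated_third_moment_tendsto_0:
  assumes u: "u \<longlonglongrightarrow> 0" and u_nonneg: "\<And>n. 0 \<le> u n"
  shows "(\<lambda>n. truncated_third_moment (u n)) \<longlonglongrightarrow> 0"
proof -
  have "(\<lambda>n. truncated_third_moment (u n)) \<longlonglongrightarrow> expectation (\<lambda>\<omega>. 0)"
    unfolding truncated_third_moment_def
  proof (rule integral_dominated_convergence[where w = "\<lambda>\<omega>. 6 * (Y 0 \<omega>)\<^sup>2"])
    have "(\<lambda>n. min (6 * (Y 0 \<omega>)\<^sup>2) (u n * \<bar>Y 0 \<omega>\<bar> ^ 3)) \<longlonglongrightarrow> 0" for \<omega>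
    proof -
      have "(\<lambda>n. min (6 * (Y 0 \<omega>)\<^sup>2) (u n * \<bar>Y 0 \<omega>\<bar> ^ 3)) \<longlonglongrightarrow> min (6 * (Y 0 \<omega>)\<^sup>2) (0 * \<bar>Y 0 \<omega>\<bar> ^ 3)"
        by (intro tendsto_intros u)
      then show ?thesis by (simp add: min_absorb2)
    qed
    then show "AE \<omega> in M. (\<lambda>n. min (6 * (Y 0 \<omega>)\<^sup>2) (u n * \<bar>Y 0 \<omega>\<bar> ^ 3)) \<longlonglongrightarrow> 0"
      by simp
  qed (use u_nonneg Y_sq_integrable0 in \<open>auto simp: min_def not_le\<close>)
  then show ?thesis by simp
qed

lemma char_Y_approx:
  "cmod (char (distr M borel (Y i)) w - exp (- (s\<^sup>2 / 2 * w\<^sup>2)))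
    \<le> w\<^sup>2 * (truncated_third_moment \<bar>w\<bar> / 6 + s ^ 4 * w\<^sup>2 / 8)"
proof -
  have "cmod (char (distr M borel (Y 0)) w - (1 - w\<^sup>2 * s\<^sup>2 / 2)) \<le> w\<^sup>2 / 6 * truncated_third_moment \<bar>w\<bar>"
    unfolding truncated_third_moment_def
    using Y_integrable Y_mean Y_sq_integrable0 Y_second_moment0
    by (intro char_approx3'[where X = "Y 0"]) auto
  moreover have "cmod (complex_of_real (1 - w\<^sup>2 * s\<^sup>2 / 2) - complex_of_real (exp (- (s\<^sup>2 / 2 * w\<^sup>2))))
      \<le> (s\<^sup>2 / 2 * w\<^sup>2)\<^sup>2 / 2"
    using exp_neg_quadratic_bound[of "s\<^sup>2 / 2 * w\<^sup>2"]
    unfolding of_real_diff[symmetric] norm_of_real by (simp add: mult.commute)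
  ultimately have "cmod (char (distr M borel (Y 0)) w - exp (- (s\<^sup>2 / 2 * w\<^sup>2)))
      \<le> w\<^sup>2 / 6 * truncated_third_moment \<bar>w\<bar> + (s\<^sup>2 / 2 * w\<^sup>2)\<^sup>2 / 2"
    by (rule norm_diff_triangle_le)
  also have "\<dots> = w\<^sup>2 * (truncated_third_moment \<bar>w\<bar> / 6 + s ^ 4 * w\<^sup>2 / 8)"
    by (simp add: algebra_simps power2_eq_square power4_eq_xxxx)
  finally show ?thesis by (simp only: law_Y[of i])
qed

text \<open>
  The Lindeberg argument for uniformly small weights: both sides are products of factors of modulus
  at most 1, so the errors of the individual factors add up.
\<close>

lemma weighted_sum_char_approx:
  assumes w: "\<And>k. \<bar>w k\<bar> \<le> v"
  shows "cmod (expectation (\<lambda>\<omega>. iexp (\<Sum>k<n. w k * Y k \<omega>)) - exp (- (s\<^sup>2 / 2 * (\<Sum>k<n. (w k)\<^sup>2))))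
    \<le> (\<Sum>k<n. (w k)\<^sup>2) * (truncated_third_moment v / 6 + s ^ 4 * v\<^sup>2 / 8)"
proof -
  have v: "0 \<le> v" using w[of 0] by linarith
  have "expectation (\<lambda>\<omega>. iexp (\<Sum>k<n. w k * Y k \<omega>))
      = char (distr M borel (\<lambda>\<omega>. \<Sum>k<n. w k * Y k \<omega>)) 1"
    by (simp add: char_def integral_distr)
  also have "\<dots> = (\<Prod>k<n. char (distr M borel (\<lambda>\<omega>. w k * Y k \<omega>)) 1)"
  proof (rule char_distr_sum)
    show "indep_vars (\<lambda>_. borel) (\<lambda>k \<omega>. w k * Y k \<omega>) {..<n}"
      by (rule indep_vars_compose2[OF indep_vars_subset[OF indep_Y]]) auto
  qed
  also have "\<dots> = (\<Prod>k<n. char (distr M borel (Y k)) (w k))"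
    by (simp add: char_def integral_distr)
  finally have 1: "expectation (\<lambda>\<omega>. iexp (\<Sum>k<n. w k * Y k \<omega>)) = (\<Prod>k<n. char (distr M borel (Y k)) (w k))" .
  have 2: "complex_of_real (exp (- (s\<^sup>2 / 2 * (\<Sum>k<n. (w k)\<^sup>2)))) = (\<Prod>k<n. complex_of_real (exp (- (s\<^sup>2 / 2 * (w k)\<^sup>2))))"
    by (simp only: of_real_prod[symmetric] exp_sum[symmetric, OF finite_lessThan] sum_distrib_left sum_negf)
  have "cmod ((\<Prod>k<n. char (distr M borel (Y k)) (w k)) - (\<Prod>k<n. complex_of_real (exp (- (s\<^sup>2 / 2 * (w k)\<^sup>2)))))
      \<le> (\<Sum>k<n. cmod (char (distr M borel (Y k)) (w k) - complex_of_real (exp (- (s\<^sup>2 / 2 * (w k)\<^sup>2)))))"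
  proof (rule norm_prod_diff)
    fix k
    interpret Yk: real_distribution "distr M borel (Y k)" by (rule real_distribution_distr) simp
    show "cmod (char (distr M borel (Y k)) (w k)) \<le> 1" by (rule Yk.cmod_char_le_1)
  qed simp
  also have "\<dots> \<le> (\<Sum>k<n. (w k)\<^sup>2 * (truncated_third_moment v / 6 + s ^ 4 * v\<^sup>2 / 8))"
  proof (rule sum_mono)
    fix k
    have "cmod (char (distr M borel (Y k)) (w k) - complex_of_real (exp (- (s\<^sup>2 / 2 * (w k)\<^sup>2))))
        \<le> (w k)\<^sup>2 * (truncated_third_moment \<bar>w k\<bar> / 6 + s ^ 4 * (w k)\<^sup>2 / 8)"
      using char_Y_approx[of k "w k"] by (simp add: exp_of_real)
    also have "\<dots> \<le> (w k)\<^sup>2 * (truncated_third_moment v / 6 + s ^ 4 * v\<^sup>2 / 8)"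
      using truncated_third_moment_mono[of "\<bar>w k\<bar>" v] w[of k] v
      by (intro mult_left_mono add_mono divide_right_mono) (auto simp: abs_le_square_iff[symmetric])
    finally show "cmod (char (distr M borel (Y k)) (w k) - complex_of_real (exp (- (s\<^sup>2 / 2 * (w k)\<^sup>2))))
        \<le> (w k)\<^sup>2 * (truncated_third_moment v / 6 + s ^ 4 * v\<^sup>2 / 8)" .
  qed
  finally show ?thesis
    unfolding 1 2 by (simp add: sum_distrib_right)
qed

section \<open>Replacing the random weights\<close>

text \<open>
  The sum over all \<open>k\<close> of the bounds that \<open>powr_diff_sq_le\<close> gives for
  \<open>(b powr walk k - b powr (\<mu> k))\<^sup>2\<close> on the tube. Multiplied by \<open>1 - b\<^sup>2\<close> it tends to
  \<open>1 / (\<mu> - \<delta>) - 1 / \<mu>\<close> as \<open>b \<rightarrow> 1-\<close>, which is small with \<open>\<delta>\<close> and does not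
  depend on \<open>C\<close>.
\<close>

definition tube_excess :: "real \<Rightarrow> real \<Rightarrow> nat \<Rightarrow> real" where
  "tube_excess b \<delta> C =
    b powr (- 2 * real C) * (1 / (1 - b powr (2 * (\<mu> - \<delta>)))) - 1 / (1 - b powr (2 * \<mu>))"

text \<open>
  The weight differences are switched off outside the tube at time \<open>k\<close> only, not outside the whole
  event, so that they remain functions of \<open>walk k\<close> and orthogonality applies.
\<close>

lemma random_weights_second_moment:
  fixes \<delta> :: real and C :: nat
  assumes b: "0 < b" "b < 1" and \<delta>: "0 < \<delta>" "\<delta> < \<mu>"
  defines "f \<equiv> \<lambda>k x. if \<bar>x - \<mu> * real k\<bar> \<le> \<delta> * real k + real C then b powr x - b powr (\<mu> * real k) else 0"
  shows "integrable M (\<lambda>\<omega>. (\<Sum>k<n. f k (walk k \<omega>) * Y k \<omega>)\<^sup>2)"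
    and "expectation (\<lambda>\<omega>. (\<Sum>k<n. f k (walk k \<omega>) * Y k \<omega>)\<^sup>2) \<le> s\<^sup>2 * tube_excess b \<delta> C"
proof -
  define c where "c k = b powr (- 2 * real C) * (b powr (2 * (\<mu> - \<delta>))) ^ k - (b powr (2 * \<mu>)) ^ k" for k
  have [measurable]: "f k \<in> borel_measurable borel" for k
    unfolding f_def by measurable
  have c_eq: "c k = b powr (2 * (\<mu> * k) - 2 * (\<delta> * k + C)) - b powr (2 * (\<mu> * k))" for k
    using b by (simp add: c_def powr_power powr_add[symmetric] algebra_simps)
  have c_nonneg: "0 \<le> c k" for k
  proof -
    have "0 \<le> \<delta> * k + C" using \<delta> by (intro add_nonneg_nonneg) auto
    then have "2 * (\<mu> * k) - 2 * (\<delta> * k + C) \<le> 2 * (\<mu> * k)" by simp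
    then show ?thesis unfolding c_eq diff_ge_0_iff_ge using b by (intro powr_mono') auto
  qed
  have f: "(f k x)\<^sup>2 \<le> c k" for k x
    using powr_diff_sq_le[OF b, of x "\<mu> * k" "\<delta> * k + C"] c_nonneg[of k] by (auto simp: f_def c_eq)
  have q: "b powr (2 * (\<mu> - \<delta>)) < 1" "b powr (2 * \<mu>) < 1"
    using b \<delta> \<mu>_pos by (simp_all add: powr01_less_one)
  have "c sums tube_excess b \<delta> C"
    unfolding c_def[abs_def] tube_excess_def
    by (rule sums_diff[OF sums_mult[OF geometric_sums] geometric_sums]) (use q in auto)
  then have "(\<Sum>k<n. c k) \<le> tube_excess b \<delta> C"
    using sum_le_suminf[of c "{..<n}"] c_nonneg by (auto simp: sums_iff)
  then have "s\<^sup>2 * (\<Sum>k<n. c k) \<le> s\<^sup>2 * tube_excess b \<delta> C"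
    by (intro mult_left_mono) auto
  with predictable_sum_second_moment[of f c n] f
  show "integrable M (\<lambda>\<omega>. (\<Sum>k<n. f k (walk k \<omega>) * Y k \<omega>)\<^sup>2)"
    and "expectation (\<lambda>\<omega>. (\<Sum>k<n. f k (walk k \<omega>) * Y k \<omega>)\<^sup>2) \<le> s\<^sup>2 * tube_excess b \<delta> C"
    by auto
qed

text \<open>
  Off the tube the two exponentials differ by at most 2; on the tube their phases differ by \<open>u\<close>
  times the sum in \<open>random_weights_second_moment\<close>, whose first absolute moment is at most the
  root of its second moment.
\<close>

lemma char_random_vs_deterministic_weights:
  fixes \<delta> :: real
  assumes b: "0 < b" "b < 1" and \<delta>: "0 < \<delta>" "\<delta> < \<mu>"
  shows "cmod (expectation (\<lambda>\<omega>. iexp (u * (\<Sum>k<n. b powr walk k \<omega> * Y k \<omega>)))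
      - expectation (\<lambda>\<omega>. iexp (u * (\<Sum>k<n. (b powr \<mu>) ^ k * Y k \<omega>))))
    \<le> 2 * prob (space M - tube \<delta> C) + \<bar>u\<bar> * sqrt (s\<^sup>2 * tube_excess b \<delta> C)"
proof -
  define f where "f = (\<lambda>k x. if \<bar>x - \<mu> * real k\<bar> \<le> \<delta> * real k + real C then b powr x - b powr (\<mu> * real k) else 0)"
  have [measurable]: "f k \<in> borel_measurable borel" for k
    unfolding f_def by measurable
  define U where "U \<omega> = (\<Sum>k<n. f k (walk k \<omega>) * Y k \<omega>)" for \<omega>
  have [measurable]: "U \<in> borel_measurable M" unfolding U_def[abs_def] by measurable
  have U2: "integrable M (\<lambda>\<omega>. (U \<omega>)\<^sup>2)" "expectation (\<lambda>\<omega>. (U \<omega>)\<^sup>2) \<le> s\<^sup>2 * tube_excess b \<delta> C"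
    unfolding U_def f_def by (rule random_weights_second_moment[OF b \<delta>])+
  have U1: "integrable M (\<lambda>\<omega>. \<bar>U \<omega>\<bar>)"
    using square_integrable_imp_integrable[OF _ U2(1)] by simp
  define A where "A \<omega> = u * (\<Sum>k<n. b powr walk k \<omega> * Y k \<omega>)" for \<omega>
  define B where "B \<omega> = u * (\<Sum>k<n. (b powr \<mu>) ^ k * Y k \<omega>)" for \<omega>
  have [measurable]: "A \<in> borel_measurable M" "B \<in> borel_measurable M"
    unfolding A_def[abs_def] B_def[abs_def] by measurable
  have int: "integrable M (\<lambda>\<omega>. iexp (A \<omega>))" "integrable M (\<lambda>\<omega>. iexp (B \<omega>))"
    by (rule integrable_const_bound[where B = 1]; simp)+
  have ind: "integrable M (indicator (space M - tube \<delta> C) :: 'a \<Rightarrow> real)"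
    by (rule integrable_const_bound[where B = 1]) (auto simp: indicator_def)
  have bound: "cmod (iexp (A \<omega>) - iexp (B \<omega>)) \<le> 2 * indicator (space M - tube \<delta> C) \<omega> + \<bar>u\<bar> * \<bar>U \<omega>\<bar>"
    if "\<omega> \<in> space M" for \<omega>
  proof (cases "\<omega> \<in> tube \<delta> C")
    case True
    then have "f k (walk k \<omega>) = b powr walk k \<omega> - (b powr \<mu>) ^ k" for k
      using b by (simp add: f_def tube_def powr_power mult.commute)
    then have "A \<omega> - B \<omega> = u * U \<omega>"
      by (simp add: A_def B_def U_def sum_subtractf left_diff_distrib right_diff_distrib)
    then show ?thesis
      using norm_iexp_diff_le[of "A \<omega>" "B \<omega>"] True by (simp add: abs_mult)
  next
    case False
    have "cmod (iexp (A \<omega>) - iexp (B \<omega>)) \<le> 2"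
      using norm_triangle_ineq4[of "iexp (A \<omega>)" "iexp (B \<omega>)"] by simp
    then show ?thesis using False that by (simp add: add_increasing2)
  qed
  have "cmod (expectation (\<lambda>\<omega>. iexp (A \<omega>)) - expectation (\<lambda>\<omega>. iexp (B \<omega>)))
      \<le> expectation (\<lambda>\<omega>. cmod (iexp (A \<omega>) - iexp (B \<omega>)))"
    using integral_norm_bound[of M "\<lambda>\<omega>. iexp (A \<omega>) - iexp (B \<omega>)"] int by simp
  also have "\<dots> \<le> expectation (\<lambda>\<omega>. 2 * indicator (space M - tube \<delta> C) \<omega> + \<bar>u\<bar> * \<bar>U \<omega>\<bar>)"
    using int U1 ind bound by (intro integral_mono integrable_norm) auto
  also have "\<dots> = 2 * prob (space M - tube \<delta> C) + \<bar>u\<bar> * expectation (\<lambda>\<omega>. \<bar>U \<omega>\<bar>)"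
    using U1 ind by (subst Bochner_Integration.integral_add) auto
  also have "\<dots> \<le> 2 * prob (space M - tube \<delta> C) + \<bar>u\<bar> * sqrt (s\<^sup>2 * tube_excess b \<delta> C)"
    using expectation_abs_le_sqrt[OF _ U2(1)] U2(2)
    by (intro add_left_mono mult_left_mono) (auto intro: order_trans)
  finally show ?thesis unfolding A_def B_def .
qed

definition perpetuity :: "real \<Rightarrow> 'a \<Rightarrow> real" where
  "perpetuity b \<omega> = (\<Sum>k. b powr walk k \<omega> * Y k \<omega>)"

lemma measurable_perpetuity [measurable]: "perpetuity b \<in> borel_measurable M"
  unfolding perpetuity_def[abs_def] by measurable

text \<open>
  The two comparisons are made for partial sums, with bounds uniform in their length. Passing to the
  limit then rests on almost sure convergence of the series and boundedness of \<open>iexp\<close>; the sum of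
  the series itself may have no moments.
\<close>

lemma char_perpetuity_approx:
  fixes \<delta> :: real
  assumes b: "0 < b" "b < 1" and \<delta>: "0 < \<delta>" "\<delta> < \<mu>"
  shows "cmod (expectation (\<lambda>\<omega>. iexp (u * perpetuity b \<omega>))
      - exp (- (s\<^sup>2 / 2 * (u\<^sup>2 / (1 - b powr (2 * \<mu>))))))
    \<le> 2 * prob (space M - tube \<delta> C) + \<bar>u\<bar> * sqrt (s\<^sup>2 * tube_excess b \<delta> C)
      + u\<^sup>2 / (1 - b powr (2 * \<mu>)) * (truncated_third_moment \<bar>u\<bar> / 6 + s ^ 4 * u\<^sup>2 / 8)"
    (is "cmod (_ - complex_of_real ?G) \<le> ?R")
proof -
  define r where "r = b powr \<mu>"
  have r: "0 < r" "r < 1" using b \<mu>_pos by (auto simp: r_def powr01_less_one)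
  have r2: "r\<^sup>2 = b powr (2 * \<mu>)" using b by (simp add: r_def powr_power)
  have r2_less: "r\<^sup>2 < 1" using r by (simp add: power_less_one_iff)
  define w where "w k = u * r ^ k" for k
  have w: "\<bar>w k\<bar> \<le> \<bar>u\<bar>" for k
    using r power_le_one[of r k] by (simp add: w_def abs_mult mult_left_le)
  have w2: "(w k)\<^sup>2 = u\<^sup>2 * (r\<^sup>2) ^ k" for k
    by (simp add: w_def power_mult_distrib power_mult[symmetric] mult.commute)
  have sum_w2: "(\<lambda>n. \<Sum>k<n. (w k)\<^sup>2) \<longlonglongrightarrow> u\<^sup>2 / (1 - b powr (2 * \<mu>))"
    using sums_mult[OF geometric_sums[of "r\<^sup>2"], of "u\<^sup>2"] r2_less
    by (simp add: sums_def w2 r2)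
  have sum_w2_le: "(\<Sum>k<n. (w k)\<^sup>2) \<le> u\<^sup>2 / (1 - b powr (2 * \<mu>))" for n
    using mult_left_mono[OF geometric_sum_le[of "r\<^sup>2" n], of "u\<^sup>2"] r2_less
    by (simp add: w2 r2 sum_distrib_left)
  have cutoff: "0 \<le> truncated_third_moment \<bar>u\<bar> / 6 + s ^ 4 * u\<^sup>2 / 8"
    unfolding truncated_third_moment_def by (intro add_nonneg_nonneg divide_nonneg_nonneg integral_nonneg_AE) auto
  define Z where "Z n \<omega> = (\<Sum>k<n. b powr walk k \<omega> * Y k \<omega>)" for n \<omega>
  have [measurable]: "Z n \<in> borel_measurable M" for n
    unfolding Z_def[abs_def] by measurable
  have partial: "cmod (expectation (\<lambda>\<omega>. iexp (u * Z n \<omega>))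
      - complex_of_real (exp (- (s\<^sup>2 / 2 * (\<Sum>k<n. (w k)\<^sup>2))))) \<le> ?R" for n
  proof -
    have "cmod (expectation (\<lambda>\<omega>. iexp (u * Z n \<omega>)) - expectation (\<lambda>\<omega>. iexp (\<Sum>k<n. w k * Y k \<omega>)))
      \<le> 2 * prob (space M - tube \<delta> C) + \<bar>u\<bar> * sqrt (s\<^sup>2 * tube_excess b \<delta> C)"
      using char_random_vs_deterministic_weights[OF b \<delta>, of u n C]
      by (simp add: Z_def w_def r_def sum_distrib_left mult.assoc)
    moreover have "cmod (expectation (\<lambda>\<omega>. iexp (\<Sum>k<n. w k * Y k \<omega>))
        - complex_of_real (exp (- (s\<^sup>2 / 2 * (\<Sum>k<n. (w k)\<^sup>2)))))
      \<le> u\<^sup>2 / (1 - b powr (2 * \<mu>)) * (truncated_third_moment \<bar>u\<bar> / 6 + s ^ 4 * u\<^sup>2 / 8)"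
      using weighted_sum_char_approx[of w "\<bar>u\<bar>" n] w mult_right_mono[OF sum_w2_le[of n] cutoff]
      by simp
    ultimately show ?thesis by (rule norm_diff_triangle_le)
  qed
  have "(\<lambda>n. expectation (\<lambda>\<omega>. iexp (u * Z n \<omega>))) \<longlonglongrightarrow> expectation (\<lambda>\<omega>. iexp (u * perpetuity b \<omega>))"
  proof (rule integral_dominated_convergence[where w = "\<lambda>_. 1"])
    show "AE \<omega> in M. (\<lambda>n. iexp (u * Z n \<omega>)) \<longlonglongrightarrow> iexp (u * perpetuity b \<omega>)"
      using AE_discounted_summable[OF b]
    proof eventually_elim
      case (elim \<omega>)
      then have "(\<lambda>n. Z n \<omega>) \<longlonglongrightarrow> perpetuity b \<omega>"
        unfolding Z_def perpetuity_def by (rule summable_LIMSEQ)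
      then show ?case by (intro tendsto_intros)
    qed
  qed auto
  moreover have "(\<lambda>n. complex_of_real (exp (- (s\<^sup>2 / 2 * (\<Sum>k<n. (w k)\<^sup>2))))) \<longlonglongrightarrow> complex_of_real ?G"
    by (intro tendsto_intros sum_w2)
  ultimately have "(\<lambda>n. cmod (expectation (\<lambda>\<omega>. iexp (u * Z n \<omega>))
      - complex_of_real (exp (- (s\<^sup>2 / 2 * (\<Sum>k<n. (w k)\<^sup>2)))))) \<longlonglongrightarrow>
      cmod (expectation (\<lambda>\<omega>. iexp (u * perpetuity b \<omega>)) - complex_of_real ?G)"
    by (intro tendsto_norm tendsto_diff)
  then show ?thesis
    by (rule LIMSEQ_le_const2) (use partial in auto)
qed

end

section \<open>The limit of the scaled series\<close>

text \<open>
  A quotient of the difference quotients at 1 of \<open>b\<^sup>2\<close> and \<open>b powr (2 * c)\<close>.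
\<close>

lemma one_minus_sq_over_one_minus_powr_tendsto:
  fixes c :: real
  assumes c: "0 < c"
  shows "((\<lambda>b. (1 - b\<^sup>2) * (1 / (1 - b powr (2 * c)))) \<longlongrightarrow> 1 / c) (at_left 1)"
proof -
  have "((\<lambda>b::real. b\<^sup>2) has_field_derivative 2) (at_left 1)"
    by (auto intro!: derivative_eq_intros)
  then have 1: "((\<lambda>b::real. (b\<^sup>2 - 1) / (b - 1)) \<longlongrightarrow> 2) (at_left 1)"
    by (simp add: has_field_derivative_iff)
  have "((\<lambda>b::real. b powr (2 * c)) has_field_derivative 2 * c) (at_left 1)"
    by (auto intro!: derivative_eq_intros)
  then have 2: "((\<lambda>b::real. (b powr (2 * c) - 1) / (b - 1)) \<longlongrightarrow> 2 * c) (at_left 1)"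
    by (simp add: has_field_derivative_iff)
  have 3: "((\<lambda>b::real. ((b\<^sup>2 - 1) / (b - 1)) / ((b powr (2 * c) - 1) / (b - 1))) \<longlongrightarrow> 2 / (2 * c)) (at_left 1)"
    using c by (intro tendsto_divide 1 2) auto
  have eq: "((b\<^sup>2 - 1) / (b - 1)) / ((b powr (2 * c) - 1) / (b - 1)) = (1 - b\<^sup>2) * (1 / (1 - b powr (2 * c)))"
    if "0 < b" "b < 1" for b :: real
  proof -
    have "b powr (2 * c) < 1" using that c by (simp add: powr01_less_one)
    then show ?thesis using that by (simp add: divide_simps) (simp add: algebra_simps)
  qed
  have "\<forall>\<^sub>F b in at_left 1. 0 < b \<and> b < (1::real)"
    using eventually_at_left_real[of 0 1] by simp
  then have "\<forall>\<^sub>F b in at_left 1. ((b\<^sup>2 - 1) / (b - 1)) / ((b powr (2 * c) - 1) / (b - 1))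
      = (1 - b\<^sup>2) * (1 / (1 - b powr (2 * c)))"
    by eventually_elim (use eq in blast)
  from 3[unfolded tendsto_cong[OF this]] show ?thesis using c by simp
qed

context iid_pairs
begin

text \<open>
  In the bound of \<open>char_perpetuity_approx\<close> at \<open>u = t * sqrt (1 - b\<^sup>2)\<close> three parameters are
  chosen in this order: \<open>\<delta>\<close> small, so that the limiting excess of the tube is small; then \<open>C\<close>
  large, so that the walk rarely leaves the tube; then \<open>b\<close> close to 1.
\<close>

lemma char_scaled_perpetuity_tendsto:
  "((\<lambda>b. expectation (\<lambda>\<omega>. iexp (t * sqrt (1 - b\<^sup>2) * perpetuity b \<omega>)))
    \<longlongrightarrow> complex_of_real (exp (- (s\<^sup>2 / 2 * (t\<^sup>2 * (1 / \<mu>)))))) (at_left 1)"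
proof -
  define u where "u b = t * sqrt (1 - b\<^sup>2)" for b
  define E where "E b = expectation (\<lambda>\<omega>. iexp (u b * perpetuity b \<omega>))" for b
  define G where "G b = complex_of_real (exp (- (s\<^sup>2 / 2 * ((u b)\<^sup>2 / (1 - b powr (2 * \<mu>))))))" for b
  have ev: "\<forall>\<^sub>F b in at_left 1. 0 < b \<and> b < (1::real)"
    using eventually_at_left_real[of 0 1] by simp
  have u_lim: "(u \<longlongrightarrow> 0) (at_left 1)"
    unfolding u_def[abs_def] by (auto intro!: tendsto_eq_intros)
  have u2: "(u b)\<^sup>2 = t\<^sup>2 * (1 - b\<^sup>2)" if "0 < b" "b < 1" for b
    using that by (simp add: u_def power_mult_distrib power_le_one)
  have var_lim: "((\<lambda>b. (u b)\<^sup>2 / (1 - b powr (2 * \<mu>))) \<longlongrightarrow> t\<^sup>2 * (1 / \<mu>)) (at_left 1)"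
  proof (rule Lim_transform_eventually)
    show "((\<lambda>b. t\<^sup>2 * ((1 - b\<^sup>2) * (1 / (1 - b powr (2 * \<mu>))))) \<longlongrightarrow> t\<^sup>2 * (1 / \<mu>)) (at_left 1)"
      by (intro tendsto_intros one_minus_sq_over_one_minus_powr_tendsto \<mu>_pos)
    show "\<forall>\<^sub>F b in at_left 1. t\<^sup>2 * ((1 - b\<^sup>2) * (1 / (1 - b powr (2 * \<mu>)))) = (u b)\<^sup>2 / (1 - b powr (2 * \<mu>))"
      using ev by eventually_elim (simp add: u2)
  qed
  have cutoff_lim: "((\<lambda>b. truncated_third_moment \<bar>u b\<bar>) \<longlongrightarrow> 0) (at_left 1)"
  proof (rule tendsto_at_left_sequentially[of 0])
    fix S :: "nat \<Rightarrow> real"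
    assume S: "\<And>n. S n < 1" "S \<longlonglongrightarrow> 1"
    have "S n \<noteq> 1" for n using S(1)[of n] by simp
    then have "filterlim S (at_left 1) sequentially"
      using S by (auto simp: filterlim_at)
    from filterlim_compose[OF u_lim this]
    have "(\<lambda>n. \<bar>u (S n)\<bar>) \<longlonglongrightarrow> 0" by (rule tendsto_rabs_zero)
    then show "(\<lambda>n. truncated_third_moment \<bar>u (S n)\<bar>) \<longlonglongrightarrow> 0"
      by (rule truncated_third_moment_tendsto_0) simp
  qed simp
  have excess_lim: "((\<lambda>b. \<bar>u b\<bar> * sqrt (s\<^sup>2 * tube_excess b \<delta> C))
      \<longlongrightarrow> \<bar>t\<bar> * sqrt (s\<^sup>2 * (1 / (\<mu> - \<delta>) - 1 / \<mu>))) (at_left 1)"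
    if \<delta>: "\<delta> < \<mu>" for \<delta> and C :: nat
  proof (rule Lim_transform_eventually)
    have "((\<lambda>b. b powr (- 2 * real C)) \<longlongrightarrow> 1) (at_left (1::real))"
      by (auto intro!: tendsto_eq_intros)
    then have "((\<lambda>b. \<bar>t\<bar> * sqrt (s\<^sup>2 * (b powr (- 2 * real C) * ((1 - b\<^sup>2) * (1 / (1 - b powr (2 * (\<mu> - \<delta>)))))
        - (1 - b\<^sup>2) * (1 / (1 - b powr (2 * \<mu>))))))
      \<longlongrightarrow> \<bar>t\<bar> * sqrt (s\<^sup>2 * (1 * (1 / (\<mu> - \<delta>)) - 1 / \<mu>))) (at_left 1)"
      using \<delta> \<mu>_pos
      by (intro tendsto_mult tendsto_const tendsto_real_sqrt tendsto_diff
          one_minus_sq_over_one_minus_powr_tendsto) auto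
    then show "((\<lambda>b. \<bar>t\<bar> * sqrt (s\<^sup>2 * (b powr (- 2 * real C) * ((1 - b\<^sup>2) * (1 / (1 - b powr (2 * (\<mu> - \<delta>)))))
        - (1 - b\<^sup>2) * (1 / (1 - b powr (2 * \<mu>))))))
      \<longlongrightarrow> \<bar>t\<bar> * sqrt (s\<^sup>2 * (1 / (\<mu> - \<delta>) - 1 / \<mu>))) (at_left 1)" by simp
    show "\<forall>\<^sub>F b in at_left 1. \<bar>t\<bar> * sqrt (s\<^sup>2 * (b powr (- 2 * real C) * ((1 - b\<^sup>2) * (1 / (1 - b powr (2 * (\<mu> - \<delta>)))))
        - (1 - b\<^sup>2) * (1 / (1 - b powr (2 * \<mu>))))) = \<bar>u b\<bar> * sqrt (s\<^sup>2 * tube_excess b \<delta> C)"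
      using ev
    proof eventually_elim
      case (elim b)
      then have "0 \<le> 1 - b\<^sup>2" by (simp add: power_le_one)
      then have "\<bar>u b\<bar> * sqrt (s\<^sup>2 * tube_excess b \<delta> C)
          = \<bar>t\<bar> * sqrt ((1 - b\<^sup>2) * (s\<^sup>2 * tube_excess b \<delta> C))"
        by (simp add: u_def abs_mult real_sqrt_mult)
      then show ?case by (simp add: tube_excess_def algebra_simps)
    qed
  qed
  have "((\<lambda>b. E b - G b) \<longlongrightarrow> 0) (at_left 1)"
  proof (rule tendstoI)
    fix \<epsilon> :: real assume \<epsilon>: "0 < \<epsilon>"
    have "((\<lambda>\<delta>. \<bar>t\<bar> * sqrt (s\<^sup>2 * (1 / (\<mu> - \<delta>) - 1 / \<mu>))) \<longlongrightarrow> 0) (at_right 0)"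
      using \<mu>_pos by (auto intro!: tendsto_eq_intros)
    then have "\<forall>\<^sub>F \<delta> in at_right 0. \<bar>t\<bar> * sqrt (s\<^sup>2 * (1 / (\<mu> - \<delta>) - 1 / \<mu>)) < \<epsilon> / 2"
      by (rule order_tendstoD) (use \<epsilon> in simp)
    moreover have "\<forall>\<^sub>F \<delta> in at_right 0. 0 < \<delta> \<and> \<delta> < \<mu>"
      using eventually_at_right_real[OF \<mu>_pos] by simp
    ultimately have "\<forall>\<^sub>F \<delta> in at_right 0. \<bar>t\<bar> * sqrt (s\<^sup>2 * (1 / (\<mu> - \<delta>) - 1 / \<mu>)) < \<epsilon> / 2 \<and> 0 < \<delta> \<and> \<delta> < \<mu>"
      by eventually_elim simp
    then obtain \<delta> where \<delta>: "\<bar>t\<bar> * sqrt (s\<^sup>2 * (1 / (\<mu> - \<delta>) - 1 / \<mu>)) < \<epsilon> / 2" "0 < \<delta>" "\<delta> < \<mu>"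
      using eventually_happens'[of "at_right (0::real)"] trivial_limit_at_right_real by blast
    have "\<forall>\<^sub>F C in sequentially. prob (space M - tube \<delta> C) < \<epsilon> / 4"
      using order_tendstoD(2)[OF prob_tube_tendsto[OF \<delta>(2)], of "\<epsilon> / 4"] \<epsilon> by simp
    then obtain C where C: "prob (space M - tube \<delta> C) < \<epsilon> / 4"
      using eventually_happens'[OF sequentially_bot] by blast
    define R where "R b = 2 * prob (space M - tube \<delta> C) + \<bar>u b\<bar> * sqrt (s\<^sup>2 * tube_excess b \<delta> C)
      + (u b)\<^sup>2 / (1 - b powr (2 * \<mu>)) * (truncated_third_moment \<bar>u b\<bar> / 6 + s ^ 4 * (u b)\<^sup>2 / 8)" for b
    have "(R \<longlongrightarrow> 2 * prob (space M - tube \<delta> C) + \<bar>t\<bar> * sqrt (s\<^sup>2 * (1 / (\<mu> - \<delta>) - 1 / \<mu>))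
      + t\<^sup>2 * (1 / \<mu>) * (0 / 6 + s ^ 4 * 0\<^sup>2 / 8)) (at_left 1)"
      unfolding R_def[abs_def]
      by (intro tendsto_add tendsto_mult tendsto_const tendsto_divide tendsto_power
          excess_lim var_lim cutoff_lim u_lim \<delta>) auto
    then have "\<forall>\<^sub>F b in at_left 1. R b < \<epsilon>"
      by (rule order_tendstoD) (use \<delta>(1) C in simp)
    then show "\<forall>\<^sub>F b in at_left 1. dist (E b - G b) 0 < \<epsilon>"
      using ev
    proof eventually_elim
      case (elim b)
      have "cmod (E b - G b) \<le> R b"
        unfolding E_def G_def R_def by (rule char_perpetuity_approx) (use elim \<delta> in auto)
      with elim show ?case by simp
    qed
  qed
  moreover have "(G \<longlongrightarrow> complex_of_real (exp (- (s\<^sup>2 / 2 * (t\<^sup>2 * (1 / \<mu>)))))) (at_left 1)"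
    unfolding G_def[abs_def] by (intro tendsto_of_real tendsto_exp tendsto_minus tendsto_mult tendsto_const var_lim)
  ultimately have "((\<lambda>b. (E b - G b) + G b) \<longlongrightarrow> 0 + complex_of_real (exp (- (s\<^sup>2 / 2 * (t\<^sup>2 * (1 / \<mu>)))))) (at_left 1)"
    by (rule tendsto_add)
  then show ?thesis by (simp add: E_def u_def)
qed

theorem scaled_perpetuity_weak_conv:
  "weak_conv_filter (\<lambda>b. distr M borel (\<lambda>\<omega>. sqrt (1 - b\<^sup>2) * perpetuity b \<omega>))
    (distr std_normal_distribution borel (\<lambda>x. sqrt (s\<^sup>2 / \<mu>) * x)) (at_left 1)"
  unfolding weak_conv_filter_def
proof (intro allI impI)
  let ?\<nu> = "\<lambda>b. distr M borel (\<lambda>\<omega>. sqrt (1 - b\<^sup>2) * perpetuity b \<omega>)"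
  let ?N = "distr std_normal_distribution borel (\<lambda>x. sqrt (s\<^sup>2 / \<mu>) * x)"
  fix x assume x: "isCont (cdf ?N) x"
  interpret std: prob_space std_normal_distribution
    by (rule prob_space_normal_density) simp
  show "((\<lambda>b. cdf (?\<nu> b) x) \<longlongrightarrow> cdf ?N x) (at_left 1)"
  proof (rule tendsto_at_left_sequentially[of 0])
    fix S :: "nat \<Rightarrow> real"
    assume S: "\<And>n. S n < 1" "S \<longlonglongrightarrow> 1"
    have "S n \<noteq> 1" for n using S(1)[of n] by simp
    then have S_lim: "filterlim S (at_left 1) sequentially"
      using S by (auto simp: filterlim_at)
    have "weak_conv_m (\<lambda>n. ?\<nu> (S n)) ?N"
    proof (rule levy_continuity)
      show "real_distribution (?\<nu> (S n))" for n
        by (rule real_distribution_distr) simp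
      show "real_distribution ?N"
        by (rule std.real_distribution_distr) simp
      fix t
      have "char ?N t = char std_normal_distribution (t * sqrt (s\<^sup>2 / \<mu>))"
        by (simp add: char_def integral_distr mult.assoc)
      also have "\<dots> = complex_of_real (exp (- (s\<^sup>2 / 2 * (t\<^sup>2 * (1 / \<mu>)))))"
        using \<mu>_pos by (simp add: char_std_normal_distribution power_mult_distrib field_simps)
      finally have N: "char ?N t = \<dots>" .
      have "char (?\<nu> b) t = expectation (\<lambda>\<omega>. iexp (t * sqrt (1 - b\<^sup>2) * perpetuity b \<omega>))" for b
        by (simp add: char_def integral_distr mult.assoc)
      then show "(\<lambda>n. char (?\<nu> (S n)) t) \<longlonglongrightarrow> char ?N t"
        unfolding N using filterlim_compose[OF char_scaled_perpetuity_tendsto S_lim] by simp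
    qed
    then show "(\<lambda>n. cdf (?\<nu> (S n)) x) \<longlonglongrightarrow> cdf ?N x"
      using x by (simp add: weak_conv_m_def weak_conv_def)
  qed simp
qed

end

theorem corollary1p4:
  fixes N :: "'b measure" and \<xi>\<^sub>0 \<eta>\<^sub>0 :: "'b \<Rightarrow> real"
    and M :: "'a measure" and \<xi> \<eta> :: "nat \<Rightarrow> 'a \<Rightarrow> real"
    and \<mu> s :: real
  assumes "prob_space N" and "prob_space M"
    and indep: "prob_space.indep_vars M (\<lambda>_. borel) (\<lambda>k \<omega>. (\<xi> k \<omega>, \<eta> k \<omega>)) {1..}"
    and copies: "\<And>k. k \<ge> 1 \<Longrightarrow>
      distr M borel (\<lambda>\<omega>. (\<xi> k \<omega>, \<eta> k \<omega>)) = distr N borel (\<lambda>\<omega>. (\<xi>\<^sub>0 \<omega>, \<eta>\<^sub>0 \<omega>))"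
    and "integrable N \<xi>\<^sub>0" and "\<mu> = prob_space.expectation N \<xi>\<^sub>0" and "\<mu> > 0"
    and "integrable N \<eta>\<^sub>0" and "prob_space.expectation N \<eta>\<^sub>0 = 0"
    and "integrable N (\<lambda>\<omega>. (\<eta>\<^sub>0 \<omega>)\<^sup>2)" and "s\<^sup>2 = prob_space.variance N \<eta>\<^sub>0" and "s\<^sup>2 > 0"
  shows "weak_conv_filter
           (\<lambda>b. distr M borel (\<lambda>\<omega>. sqrt (1 - b\<^sup>2) * discounted_sum \<xi> \<eta> b \<omega>))
           (distr std_normal_distribution borel (\<lambda>x. sqrt (s\<^sup>2 / \<mu>) * x))
           (at_left 1)"
proof -
  interpret N: prob_space N by fact
  interpret M: prob_space M by fact
  have N_rv [measurable]: "\<xi>\<^sub>0 \<in> borel_measurable N" "\<eta>\<^sub>0 \<in> borel_measurable N"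
    using assms by auto
  have M_rv: "(\<lambda>\<omega>. (\<xi> (Suc i) \<omega>, \<eta> (Suc i) \<omega>)) \<in> borel_measurable M" for i
    using indep by (simp add: M.indep_vars_def2)
  have N_rv_pair: "(\<lambda>\<omega>. (\<xi>\<^sub>0 \<omega>, \<eta>\<^sub>0 \<omega>)) \<in> borel_measurable N" by simp
  have law1: "distr M borel (\<lambda>\<omega>. (\<xi> 1 \<omega>, \<eta> 1 \<omega>)) = distr N borel (\<lambda>\<omega>. (\<xi>\<^sub>0 \<omega>, \<eta>\<^sub>0 \<omega>))"
    by (rule copies) simp
  have transfer: "integrable M (\<lambda>\<omega>. f (\<xi> 1 \<omega>, \<eta> 1 \<omega>)) = integrable N (\<lambda>\<omega>. f (\<xi>\<^sub>0 \<omega>, \<eta>\<^sub>0 \<omega>))"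
    "M.expectation (\<lambda>\<omega>. f (\<xi> 1 \<omega>, \<eta> 1 \<omega>)) = N.expectation (\<lambda>\<omega>. f (\<xi>\<^sub>0 \<omega>, \<eta>\<^sub>0 \<omega>))"
    if f: "f \<in> borel_measurable borel" for f :: "real \<times> real \<Rightarrow> real"
  proof -
    have M1: "(\<lambda>\<omega>. (\<xi> 1 \<omega>, \<eta> 1 \<omega>)) \<in> borel_measurable M"
      using M_rv[of 0] by simp
    show "integrable M (\<lambda>\<omega>. f (\<xi> 1 \<omega>, \<eta> 1 \<omega>)) = integrable N (\<lambda>\<omega>. f (\<xi>\<^sub>0 \<omega>, \<eta>\<^sub>0 \<omega>))"
      by (simp only: integrable_distr_eq[OF M1 f, symmetric] integrable_distr_eq[OF N_rv_pair f, symmetric] law1)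
    show "M.expectation (\<lambda>\<omega>. f (\<xi> 1 \<omega>, \<eta> 1 \<omega>)) = N.expectation (\<lambda>\<omega>. f (\<xi>\<^sub>0 \<omega>, \<eta>\<^sub>0 \<omega>))"
      by (simp only: integral_distr[OF M1 f, symmetric] integral_distr[OF N_rv_pair f, symmetric] law1)
  qed
  have fst_snd: "fst \<in> borel_measurable (borel :: (real \<times> real) measure)"
    "snd \<in> borel_measurable (borel :: (real \<times> real) measure)"
    by (simp_all add: borel_prod[symmetric])
  interpret iid_pairs M "\<lambda>i. \<xi> (Suc i)" "\<lambda>i. \<eta> (Suc i)" \<mu> s
  proof
    \<comment> \<open>Reindexing from \<open>{1..}\<close> to all natural numbers, by grouping into singletons.\<close>
    have "M.indep_vars (\<lambda>i. Pi\<^sub>M {Suc i} (\<lambda>_. borel)) (\<lambda>i \<omega>. restrict (\<lambda>k. (\<xi> k \<omega>, \<eta> k \<omega>)) {Suc i}) UNIV"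
      by (rule M.indep_vars_restrict[OF indep]) (auto simp: disjoint_family_on_def)
    from M.indep_vars_compose2[OF this, of "\<lambda>i p. p (Suc i)" "\<lambda>_. borel"]
    show "M.indep_vars (\<lambda>_. borel) (\<lambda>i \<omega>. (\<xi> (Suc i) \<omega>, \<eta> (Suc i) \<omega>)) UNIV"
      by (simp add: measurable_component_singleton)
    show "distr M borel (\<lambda>\<omega>. (\<xi> (Suc i) \<omega>, \<eta> (Suc i) \<omega>)) = distr M borel (\<lambda>\<omega>. (\<xi> (Suc 0) \<omega>, \<eta> (Suc 0) \<omega>))" for i
      using copies[of "Suc i"] copies[of "Suc 0"] by simp
    show "integrable M (\<xi> (Suc 0))" "M.expectation (\<xi> (Suc 0)) = \<mu>" "M.expectation (\<eta> (Suc 0)) = 0"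
      using transfer[OF fst_snd(1)] transfer[OF fst_snd(2)] assms by simp_all
    have "(\<lambda>p. (snd p)\<^sup>2) \<in> borel_measurable (borel :: (real \<times> real) measure)"
      using fst_snd by measurable
    from transfer[OF this] show "integrable M (\<lambda>\<omega>. (\<eta> (Suc 0) \<omega>)\<^sup>2)" "M.expectation (\<lambda>\<omega>. (\<eta> (Suc 0) \<omega>)\<^sup>2) = s\<^sup>2"
      using assms by simp_all
    show "0 < \<mu>" by fact
  qed
  have "random_walk \<xi> k \<omega> = walk k \<omega>" for k \<omega>
    by (simp add: random_walk_def walk_def sum.atLeast1_atMost_eq)
  then have "discounted_sum \<xi> \<eta> = perpetuity"
    by (simp add: fun_eq_iff discounted_sum_def perpetuity_def)
  then show ?thesis
    using scaled_perpetuity_weak_conv by simp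
qed

end
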